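(* Let $M$ be a smooth $n$-dimensional manifold covered by a chart $(x^1,\dots,x^n)$ in which the volume form is $V=dx^1\wedge\dots\wedge dx^n$, and let $\pi=\sum_{i<j}\pi^{ij}\frac{\partial}{\partial x^i}\wedge\frac{\partial}{\partial x^j}$ be a Poisson bivector on $M$. Then $m\in C^\infty(M)$ is a last multiplier of $(M,\pi,V)$, i.e. $D_V(m\pi)=0$, if and only if $$\sum_{j=1}^n\frac{\partial(m\pi^{ij})}{\partial x^j}=0\qquad\text{for all }1\le i\le n.$$
   Context: The coefficients are extended skew-symmetrically: $\pi^{ji}=-\pi^{ij}$, $\pi^{ii}=0$. $\mathcal X^k(M)$ is the $C^\infty(M)$-module of $k$-vector fields on $M$ and $\Lambda^k(M)$ the module of differential $k$-forms. For $A\in\mathcal X^k(M)$ the contraction $i_A:\Lambda^p(M)\to\Lambda^{p-k}(M)$ is defined by $\langle i_A\omega,B\rangle=\langle\omega,A\wedge B\rangle$ for all $B\in\mathcal X^{p-k}(M)$ if $p\ge k$, and $i_A\omega=0$ if $p<k$. The map $V^\flat:\mathcal X^k(M)\to\Lambda^{n-k}(M)$, $V^\flat(A)=i_AV$, is a $C^\infty(M)$-isomorphism with inverse $V^\natural$, and the curl operator is $D_V=V^\natural\circ d\circ V^\flat:\mathcal X^k(M)\to\mathcal X^{k-1}(M)$. *)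

theory Defs
  imports "HOL-Analysis.Analysis"
begin

(* The manifold M is the type 'm. A global chart x : M -> R^n (n = CARD('n)) is a homeomorphism
   onto an open subset of R^n; the smooth structure of M is the one in which x is a chart. *)

definition global_chart :: "('m::topological_space \<Rightarrow> real ^ 'n) \<Rightarrow> bool" where
  "global_chart x \<longleftrightarrow> open (range x) \<and> homeomorphism UNIV (range x) x (inv x)"

primrec Ck_on :: "nat \<Rightarrow> (real ^ 'n) set \<Rightarrow> (real ^ 'n \<Rightarrow> real) \<Rightarrow> bool" where
  "Ck_on 0 U f \<longleftrightarrow> continuous_on U f"
| "Ck_on (Suc k) U f \<longleftrightarrow> (\<forall>u\<in>U. f differentiable (at u)) \<and>
      (\<forall>v. Ck_on k U (\<lambda>u. frechet_derivative f (at u) v))"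

definition smooth_functions :: "('m \<Rightarrow> real ^ 'n) \<Rightarrow> ('m \<Rightarrow> real) set" where
  "smooth_functions x = {f. \<forall>k. Ck_on k (range x) (f \<circ> inv x)}"

definition chart_partial :: "('m \<Rightarrow> real ^ 'n) \<Rightarrow> 'n \<Rightarrow> ('m \<Rightarrow> real) \<Rightarrow> 'm \<Rightarrow> real" where
  "chart_partial x i f p = frechet_derivative (f \<circ> inv x) (at (x p)) (axis i 1)"

(* An element of the exterior algebra on basis vectors e_i, i :: 'n, is the family of its
   coefficients with respect to the basis of monomials e_I = e_{i_1} /\ ... /\ e_{i_k},
   where I = {i_1 < ... < i_k}. The type serves both for multivectors (e_i = d/dx^i) and for
   exterior covectors (e_i = dx^i). *)

type_synonym 'n ext = "'n set \<Rightarrow> real"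

definition ext_basis :: "'n set \<Rightarrow> 'n ext" where
  "ext_basis I = (\<lambda>J. if J = I then 1 else 0)"

(* For disjoint I and J: e_I /\ e_J = wedge_sign I J * e_(I \<union> J). *)
definition wedge_sign :: "'n::linorder set \<Rightarrow> 'n set \<Rightarrow> real" where
  "wedge_sign I J = (-1) ^ card {(i, j). i \<in> I \<and> j \<in> J \<and> j < i}"

definition wedge :: "'n::{finite,linorder} ext \<Rightarrow> 'n ext \<Rightarrow> 'n ext" where
  "wedge a b = (\<lambda>K. \<Sum>I\<in>Pow K. wedge_sign I (K - I) * a I * b (K - I))"

type_synonym ('m, 'n) ext_field = "'m \<Rightarrow> 'n ext"

definition wedge_field ::
    "('m, 'n::{finite,linorder}) ext_field \<Rightarrow> ('m, 'n) ext_field \<Rightarrow> ('m, 'n) ext_field" where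
  "wedge_field A B = (\<lambda>p. wedge (A p) (B p))"

definition homogeneous_fields ::
    "('m \<Rightarrow> real ^ 'n) \<Rightarrow> nat \<Rightarrow> ('m, 'n) ext_field set" where
  "homogeneous_fields x k = {A. (\<forall>I. (\<lambda>p. A p I) \<in> smooth_functions x) \<and>
                                 (\<forall>p I. card I \<noteq> k \<longrightarrow> A p I = 0)}"

(* Both modules are free over the smooth functions because x is a global chart; coefficients
   refer to the frame d/dx^i for multivector fields and to the coframe dx^i for forms. *)

abbreviation multivector_fields ::
    "('m \<Rightarrow> real ^ 'n) \<Rightarrow> nat \<Rightarrow> ('m, 'n) ext_field set" where
  "multivector_fields \<equiv> homogeneous_fields"

abbreviation diff_forms ::
    "('m \<Rightarrow> real ^ 'n) \<Rightarrow> nat \<Rightarrow> ('m, 'n) ext_field set" where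
  "diff_forms \<equiv> homogeneous_fields"

definition coord_vector_field :: "'n \<Rightarrow> ('m, 'n) ext_field" where
  "coord_vector_field i = (\<lambda>p. ext_basis {i})"

definition coord_form :: "'n \<Rightarrow> ('m, 'n) ext_field" where
  "coord_form i = (\<lambda>p. ext_basis {i})"

definition scalar_form :: "('m \<Rightarrow> real) \<Rightarrow> ('m, 'n) ext_field" where
  "scalar_form f = (\<lambda>p I. if I = {} then f p else 0)"

(* dx^1 /\ ... /\ dx^n, in the order of the index type *)
definition coord_volume :: "('m, 'n::{finite,linorder}) ext_field" where
  "coord_volume = foldr wedge_field (map coord_form (sorted_list_of_set UNIV)) (scalar_form (\<lambda>p. 1))"

definition scale_field ::
    "('m \<Rightarrow> real) \<Rightarrow> ('m, 'n) ext_field \<Rightarrow> ('m, 'n) ext_field" where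
  "scale_field f A = (\<lambda>p I. f p * A p I)"

(* Normalised by <a_1 /\ ... /\ a_k, X_1 /\ ... /\ X_k> = det (a_i(X_j)). *)
definition pairing ::
    "('m, 'n::finite) ext_field \<Rightarrow> ('m, 'n) ext_field \<Rightarrow> 'm \<Rightarrow> real" where
  "pairing \<omega> A = (\<lambda>p. \<Sum>I\<in>UNIV. \<omega> p I * A p I)"

definition ext_deriv ::
    "('m \<Rightarrow> real ^ 'n::{finite,linorder}) \<Rightarrow> ('m, 'n) ext_field \<Rightarrow> ('m, 'n) ext_field" where
  "ext_deriv x \<omega> = (\<lambda>p K. \<Sum>i\<in>UNIV.
      wedge_field (coord_form i) (\<lambda>q I. chart_partial x i (\<lambda>r. \<omega> r I) q) p K)"

(* The contraction of a p-form by a k-vector field. *)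
definition contraction ::
    "('m \<Rightarrow> real ^ 'n::{finite,linorder}) \<Rightarrow> nat \<Rightarrow> nat \<Rightarrow>
     ('m, 'n) ext_field \<Rightarrow> ('m, 'n) ext_field \<Rightarrow> ('m, 'n) ext_field" where
  "contraction x k p A \<omega> =
     (if k \<le> p
      then (THE \<eta>. \<eta> \<in> diff_forms x (p - k) \<and>
             (\<forall>B\<in>multivector_fields x (p - k). pairing \<eta> B = pairing \<omega> (wedge_field A B)))
      else (\<lambda>q I. 0))"

definition V_flat ::
    "('m \<Rightarrow> real ^ 'n::{finite,linorder}) \<Rightarrow> ('m, 'n) ext_field \<Rightarrow> nat \<Rightarrow>
     ('m, 'n) ext_field \<Rightarrow> ('m, 'n) ext_field" where
  "V_flat x V k A = contraction x k CARD('n) A V"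

definition V_natural ::
    "('m \<Rightarrow> real ^ 'n::{finite,linorder}) \<Rightarrow> ('m, 'n) ext_field \<Rightarrow> nat \<Rightarrow>
     ('m, 'n) ext_field \<Rightarrow> ('m, 'n) ext_field" where
  "V_natural x V k = the_inv_into (multivector_fields x k) (V_flat x V k)"

(* The curl operator on k-vector fields, for k >= 1. *)
definition curl ::
    "('m \<Rightarrow> real ^ 'n::{finite,linorder}) \<Rightarrow> ('m, 'n) ext_field \<Rightarrow> nat \<Rightarrow>
     ('m, 'n) ext_field \<Rightarrow> ('m, 'n) ext_field" where
  "curl x V k = V_natural x V (k - 1) \<circ> ext_deriv x \<circ> V_flat x V k"

definition bracket ::
    "('m \<Rightarrow> real ^ 'n::{finite,linorder}) \<Rightarrow> ('m, 'n) ext_field \<Rightarrow>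
     ('m \<Rightarrow> real) \<Rightarrow> ('m \<Rightarrow> real) \<Rightarrow> 'm \<Rightarrow> real" where
  "bracket x \<pi> f g =
     pairing (wedge_field (ext_deriv x (scalar_form f)) (ext_deriv x (scalar_form g))) \<pi>"

definition poisson_bivector ::
    "('m \<Rightarrow> real ^ 'n::{finite,linorder}) \<Rightarrow> ('m, 'n) ext_field \<Rightarrow> bool" where
  "poisson_bivector x \<pi> \<longleftrightarrow> \<pi> \<in> multivector_fields x 2 \<and>
     (\<forall>f\<in>smooth_functions x. \<forall>g\<in>smooth_functions x. \<forall>h\<in>smooth_functions x. \<forall>p.
        bracket x \<pi> f (bracket x \<pi> g h) p + bracket x \<pi> g (bracket x \<pi> h f) p
        + bracket x \<pi> h (bracket x \<pi> f g) p = 0)"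

definition last_multiplier ::
    "('m \<Rightarrow> real ^ 'n::{finite,linorder}) \<Rightarrow> ('m, 'n) ext_field \<Rightarrow> ('m, 'n) ext_field \<Rightarrow>
     ('m \<Rightarrow> real) \<Rightarrow> bool" where
  "last_multiplier x V \<pi> m \<longleftrightarrow> curl x V 2 (scale_field m \<pi>) = (\<lambda>p I. 0)"

end

theory Submission
  imports Defs
begin

text \<open>
  In coordinates \<open>V\<^sup>\<flat>\<close> sends the coefficient of \<open>A\<close> at \<open>I\<close>, up to a sign, to the coefficient of a form
  at the complement of \<open>I\<close>. Carrying \<open>d\<close> back along this bijection leaves a single sign: the
  coefficient of \<open>D\<^sub>V A\<close> at \<open>J\<close> is the sum over \<open>i \<notin> J\<close> of \<open>\<partial>\<^sub>i A\<close> at \<open>J \<union> {i}\<close>, with the sign of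
  \<open>e\<^sub>J \<and> e\<^sub>i\<close>. For the bivector \<open>m \<pi>\<close> and \<open>J = {i}\<close> this is the sum in the statement.
\<close>

section \<open>Smooth functions in a chart\<close>

text \<open>On an open set, Frechet derivatives depend only on the values in that set. Derivative
  formulas valid only on \<open>U\<close> can therefore be substituted inside
  \<open>Ck_on\<close>.\<close>

lemma Ck_on_cong:
  assumes "open U" "\<And>u. u \<in> U \<Longrightarrow> f u = g u"
  shows "Ck_on k U f \<longleftrightarrow> Ck_on k U g"
proof -
  have "Ck_on k U g" if "Ck_on k U f" "\<And>u. u \<in> U \<Longrightarrow> f u = g u" for f g
    using that
  proof (induction k arbitrary: f g)
    case 0
    then show ?case using continuous_on_cong by fastforce
  next
    case (Suc k)
    have diff: "f differentiable (at u)" if "u \<in> U" for u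
      using Suc.prems(1) that by simp
    have "g differentiable (at u)" if "u \<in> U" for u
      using diff[OF that] Suc.prems(2) that assms(1)
      unfolding differentiable_def by (metis has_derivative_transform_within_open)
    moreover have "frechet_derivative f (at u) = frechet_derivative g (at u)" if "u \<in> U" for u
      using frechet_derivative_transform_within_open[OF diff[OF that] assms(1) that] Suc.prems(2)
      by blast
    then have "Ck_on k U (\<lambda>u. frechet_derivative g (at u) v)" for v
      using Suc.IH[of "\<lambda>u. frechet_derivative f (at u) v" "\<lambda>u. frechet_derivative g (at u) v"]
        Suc.prems(1) by simp
    ultimately show ?case by simp
  qed
  from this[of f g] this[of g f] show ?thesis using assms(2) by auto
qed

text \<open>Serves the product rule, whose undifferentiated factors are known at order
  \<open>Suc k\<close> while the induction hypothesis there asks for order \<open>k\<close>.\<close>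

lemma Ck_on_SucD: "Ck_on (Suc k) U f \<Longrightarrow> Ck_on k U f"
proof (induction k arbitrary: f)
  case 0
  then show ?case
    by (auto simp: continuous_on_eq_continuous_at differentiable_imp_continuous_within
        intro!: continuous_at_imp_continuous_on)
next
  case (Suc k)
  then show ?case using Ck_on.simps(2) by blast
qed

lemma Ck_on_const: "Ck_on k U (\<lambda>u. a)"
  by (induction k arbitrary: a) simp_all

lemma Ck_on_add:
  assumes "open U" "Ck_on k U f" "Ck_on k U g"
  shows "Ck_on k U (\<lambda>u. f u + g u)"
  using assms(2,3)
proof (induction k arbitrary: f g)
  case 0
  then show ?case by (simp add: continuous_on_add)
next
  case (Suc k)
  have "frechet_derivative (\<lambda>u. f u + g u) (at u) =
      (\<lambda>v. frechet_derivative f (at u) v + frechet_derivative g (at u) v)" if "u \<in> U" for u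
    using Suc.prems that
    by (intro frechet_derivative_at[symmetric] has_derivative_add)
      (simp_all add: frechet_derivative_works[symmetric])
  then have "Ck_on k U (\<lambda>u. frechet_derivative (\<lambda>u. f u + g u) (at u) v)" for v
    using Suc by (subst Ck_on_cong[OF assms(1)]) auto
  then show ?case using Suc.prems by simp
qed

lemma Ck_on_mult:
  assumes "open U" "Ck_on k U f" "Ck_on k U g"
  shows "Ck_on k U (\<lambda>u. f u * g u)"
  using assms(2,3)
proof (induction k arbitrary: f g)
  case 0
  then show ?case by (simp add: continuous_on_mult)
next
  case (Suc k)
  have "frechet_derivative (\<lambda>u. f u * g u) (at u) =
      (\<lambda>v. f u * frechet_derivative g (at u) v + frechet_derivative f (at u) v * g u)"
    if "u \<in> U" for u
    using Suc.prems that
    by (intro frechet_derivative_at[symmetric] has_derivative_mult)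
      (simp_all add: frechet_derivative_works[symmetric])
  moreover have "Ck_on k U (\<lambda>u. f u * frechet_derivative g (at u) v
      + frechet_derivative f (at u) v * g u)" for v
    using Suc.prems Suc.IH Ck_on_SucD[OF Suc.prems(1)] Ck_on_SucD[OF Suc.prems(2)]
    by (intro Ck_on_add[OF assms(1)]) simp_all
  ultimately have "Ck_on k U (\<lambda>u. frechet_derivative (\<lambda>u. f u * g u) (at u) v)" for v
    by (subst Ck_on_cong[OF assms(1)]) auto
  then show ?case using Suc.prems by simp
qed

context
  fixes x :: "'m::topological_space \<Rightarrow> real ^ 'n"
  assumes chart: "global_chart x"
begin

lemma inv_chart: "inv x (x p) = p"
  using chart by (simp add: global_chart_def homeomorphism_def)

lemma open_range_chart: "open (range x)"
  using chart by (simp add: global_chart_def)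

lemma smooth_const: "(\<lambda>p. a) \<in> smooth_functions x"
  by (simp add: smooth_functions_def o_def Ck_on_const)

lemma smooth_add:
  "f \<in> smooth_functions x \<Longrightarrow> g \<in> smooth_functions x \<Longrightarrow> (\<lambda>p. f p + g p) \<in> smooth_functions x"
  by (simp add: smooth_functions_def o_def Ck_on_add open_range_chart)

lemma smooth_mult:
  "f \<in> smooth_functions x \<Longrightarrow> g \<in> smooth_functions x \<Longrightarrow> (\<lambda>p. f p * g p) \<in> smooth_functions x"
  by (simp add: smooth_functions_def o_def Ck_on_mult open_range_chart)

lemma smooth_sum:
  "(\<And>i. i \<in> S \<Longrightarrow> f i \<in> smooth_functions x) \<Longrightarrow> (\<lambda>p. \<Sum>i\<in>S. f i p) \<in> smooth_functions x"
  by (induction S rule: infinite_finite_induct) (simp_all add: smooth_const smooth_add)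

lemma smooth_chart_partial:
  assumes "f \<in> smooth_functions x"
  shows "chart_partial x i f \<in> smooth_functions x"
proof -
  have "Ck_on k (range x) (chart_partial x i f \<circ> inv x)" for k
  proof -
    have "Ck_on (Suc k) (range x) (f \<circ> inv x)"
      using assms unfolding smooth_functions_def by blast
    then have "Ck_on k (range x) (\<lambda>u. frechet_derivative (f \<circ> inv x) (at u) (axis i 1))"
      by simp
    \<comment> \<open>The two functions agree only on \<open>range x\<close>, where
      \<open>x (inv x u) = u\<close>; hence the congruence on this open set.\<close>
    then show ?thesis
      by (subst Ck_on_cong[OF open_range_chart]) (auto simp: chart_partial_def inv_chart)
  qed
  then show ?thesis by (simp add: smooth_functions_def)
qed

lemma chart_partial_const: "chart_partial x i (\<lambda>p. a) p = 0"
  by (simp add: chart_partial_def o_def)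

text \<open>Moves wedge signs through partial derivatives. Smoothness ensures that the derivative
  exists, \<open>frechet_derivative\<close> being an unspecified choice otherwise.\<close>

lemma chart_partial_cmult:
  assumes "f \<in> smooth_functions x"
  shows "chart_partial x i (\<lambda>p. a * f p) p = a * chart_partial x i f p"
proof -
  have "Ck_on (Suc 0) (range x) (f \<circ> inv x)"
    using assms unfolding smooth_functions_def by blast
  then have "((f \<circ> inv x) has_derivative frechet_derivative (f \<circ> inv x) (at (x p))) (at (x p))"
    by (simp add: frechet_derivative_works[symmetric])
  from frechet_derivative_at[OF has_derivative_mult_right[OF this, of a]]
  show ?thesis by (simp add: chart_partial_def o_def fun_eq_iff)
qed

end

section \<open>Wedge products of basis monomials\<close>

lemma wedge_sign_mult_self: "wedge_sign I J * wedge_sign I J = 1"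
  by (simp add: wedge_sign_def power_add[symmetric] mult_2[symmetric])

text \<open>The inversions split into two disjoint sets, according to the part of the union that
  holds the left index, so the exponents add.\<close>

lemma wedge_sign_Un_left:
  fixes I I' J :: "'n::{finite,linorder} set"
  assumes "I \<inter> I' = {}"
  shows "wedge_sign (I \<union> I') J = wedge_sign I J * wedge_sign I' J"
proof -
  have "{(i, j). i \<in> I \<union> I' \<and> j \<in> J \<and> j < i} =
      {(i, j). i \<in> I \<and> j \<in> J \<and> j < i} \<union> {(i, j). i \<in> I' \<and> j \<in> J \<and> j < i}"
    by auto
  then show ?thesis
    using assms unfolding wedge_sign_def power_add[symmetric]
    by (subst card_Un_disjoint[symmetric]) auto
qed

lemma wedge_sign_Un_right:
  fixes I J J' :: "'n::{finite,linorder} set"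
  assumes "J \<inter> J' = {}"
  shows "wedge_sign I (J \<union> J') = wedge_sign I J * wedge_sign I J'"
proof -
  have "{(i, j). i \<in> I \<and> j \<in> J \<union> J' \<and> j < i} =
      {(i, j). i \<in> I \<and> j \<in> J \<and> j < i} \<union> {(i, j). i \<in> I \<and> j \<in> J' \<and> j < i}"
    by auto
  then show ?thesis
    using assms unfolding wedge_sign_def power_add[symmetric]
    by (subst card_Un_disjoint[symmetric]) auto
qed

lemma wedge_sign_less:
  assumes "\<And>i j. i \<in> I \<Longrightarrow> j \<in> J \<Longrightarrow> i < j"
  shows "wedge_sign I J = 1"
proof -
  have "{(i, j). i \<in> I \<and> j \<in> J \<and> j < i} = {}"
    using assms by fastforce
  then show ?thesis unfolding wedge_sign_def by (metis card.empty power_0)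
qed

lemma wedge_sign_singletons: "wedge_sign {i} {j} = (if j < i then -1 else 1)"
proof -
  have "{(i', j'). i' \<in> {i} \<and> j' \<in> {j} \<and> j' < i'} = (if j < i then {(i, j)} else {})"
    by auto
  then show ?thesis by (simp add: wedge_sign_def)
qed

lemma wedge_ext_basis_left:
  "wedge (ext_basis I) b K = (if I \<subseteq> K then wedge_sign I (K - I) * b (K - I) else 0)"
proof -
  have "wedge (ext_basis I) b K =
      (\<Sum>J\<in>Pow K. if J = I then wedge_sign I (K - I) * b (K - I) else 0)"
    unfolding wedge_def ext_basis_def by (intro sum.cong) auto
  then show ?thesis by simp
qed

lemma wedge_ext_basis:
  assumes "I \<inter> J = {}"
  shows "wedge (ext_basis I) (ext_basis J) = (\<lambda>K. wedge_sign I J * ext_basis (I \<union> J) K)"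
proof
  fix K
  show "wedge (ext_basis I) (ext_basis J) K = wedge_sign I J * ext_basis (I \<union> J) K"
  proof (cases "K = I \<union> J")
    case True
    then have "I \<subseteq> K" "K - I = J"
      using assms by blast+
    then show ?thesis
      unfolding wedge_ext_basis_left using True by (simp add: ext_basis_def)
  next
    case False
    then have "\<not> I \<subseteq> K \<or> K - I \<noteq> J"
      by blast
    then show ?thesis
      unfolding wedge_ext_basis_left using False by (auto simp: ext_basis_def)
  qed
qed

lemma wedge_coord_vector_fields:
  assumes "i < j"
  shows "wedge_field (coord_vector_field i) (coord_vector_field j) p = ext_basis {i, j}"
proof -
  have "wedge_sign {i} {j} = 1"
    using assms by (auto intro: wedge_sign_less)
  then show ?thesis
    using assms wedge_ext_basis[of "{i}" "{j}"]
    by (simp add: wedge_field_def coord_vector_field_def insert_commute)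
qed

text \<open>In a strictly sorted list each new factor precedes all factors already multiplied, so no
  sign arises. The induction needs arbitrary such lists, not just the full one.\<close>

lemma coord_volume_eq: "coord_volume p = (ext_basis UNIV :: 'n::{finite,linorder} ext)"
proof -
  have "foldr wedge_field (map coord_form xs) (scalar_form (\<lambda>p. 1)) p = ext_basis (set xs)"
    if "sorted_wrt (<) xs" for xs :: "'n list"
    using that
  proof (induction xs)
    case Nil
    then show ?case by (auto simp: scalar_form_def ext_basis_def)
  next
    case (Cons i xs)
    have "wedge_sign {i} (set xs) = 1" "i \<notin> set xs"
      using Cons.prems by (auto intro: wedge_sign_less)
    then have "wedge (ext_basis {i}) (ext_basis (set xs)) = ext_basis (set (i # xs))"
      using wedge_ext_basis[of "{i}" "set xs"] by simp
    then show ?case using Cons by (simp add: wedge_field_def coord_form_def)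
  qed
  from this[of "sorted_list_of_set UNIV"] show ?thesis
    by (simp add: coord_volume_def)
qed

section \<open>The curl operator in coordinates\<close>

text \<open>The coordinate form of \<open>V_flat\<close>, for all degrees at once. The sign compares
  the monomial of \<open>- J\<close> wedged with that of \<open>J\<close> to the full
  monomial.\<close>

definition volume_dual :: "('m, 'n::{finite,linorder}) ext_field \<Rightarrow> ('m, 'n) ext_field" where
  "volume_dual A = (\<lambda>p J. wedge_sign (- J) J * A p (- J))"

text \<open>The coordinate form of the curl. At \<open>J = {}\<close> all signs are 1 and it is the
  classical divergence of a vector field.\<close>

definition divergence ::
    "('m \<Rightarrow> real ^ 'n::{finite,linorder}) \<Rightarrow> ('m, 'n) ext_field \<Rightarrow> ('m, 'n) ext_field" where
  "divergence x A = (\<lambda>p J. \<Sum>i\<in>- J.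
      wedge_sign J {i} * chart_partial x i (\<lambda>q. A q (insert i J)) p)"

text \<open>The volume form sees only the top coefficient of the wedge product, a sum over pairs of
  complementary index sets. This is the identity that characterises the contraction.\<close>

lemma pairing_coord_volume_wedge:
  fixes A B :: "('m, 'n::{finite,linorder}) ext_field"
  shows
  "pairing coord_volume (wedge_field A B) = pairing (volume_dual A) B"
proof
  fix p
  have "pairing coord_volume (wedge_field A B) p =
      (\<Sum>I\<in>UNIV. if I = (UNIV :: 'n set) then wedge (A p) (B p) UNIV else 0)"
    unfolding pairing_def coord_volume_eq
    by (intro sum.cong) (auto simp: ext_basis_def wedge_field_def)
  also have "\<dots> = (\<Sum>I\<in>UNIV. wedge_sign I (- I) * A p I * B p (- I))"
    by (simp add: wedge_def Compl_eq_Diff_UNIV)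
  also have "\<dots> = (\<Sum>J\<in>UNIV. wedge_sign (- J) J * A p (- J) * B p J)"
    by (rule sum.reindex_bij_witness[where i = uminus and j = uminus]) auto
  finally show "pairing coord_volume (wedge_field A B) p = pairing (volume_dual A) B p"
    by (simp add: pairing_def volume_dual_def)
qed

lemma inj_volume_dual: "inj volume_dual"
proof (rule injI)
  fix A B :: "('m, 'n::{finite,linorder}) ext_field"
  assume eq: "volume_dual A = volume_dual B"
  have "A p I = B p I" for p I
  proof -
    have "wedge_sign I (- I) * A p I = wedge_sign I (- I) * B p I"
      using fun_cong[OF fun_cong[OF eq, of p], of "- I"] by (simp add: volume_dual_def)
    then show ?thesis
      using wedge_sign_mult_self[of I "- I"] by auto
  qed
  then show "A = B" by blast
qed

context
  fixes x :: "'m::topological_space \<Rightarrow> real ^ 'n::{finite,linorder}"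
  assumes chart: "global_chart x"
begin

lemma volume_dual_homogeneous:
  assumes "A \<in> homogeneous_fields x k" "k \<le> CARD('n)"
  shows "volume_dual A \<in> homogeneous_fields x (CARD('n) - k)"
proof -
  have "card (- I) \<noteq> k" if "card I \<noteq> CARD('n) - k" for I :: "'n set"
    using that assms(2) card_Diff_subset[of I UNIV] card_mono[of UNIV I]
    by (auto simp: Compl_eq_Diff_UNIV)
  then have "volume_dual A p I = 0" if "card I \<noteq> CARD('n) - k" for p I
    using assms(1) that by (simp add: homogeneous_fields_def volume_dual_def)
  moreover have "(\<lambda>p. volume_dual A p I) \<in> smooth_functions x" for I
    unfolding volume_dual_def using assms(1)
    by (intro smooth_mult smooth_const chart) (simp add: homogeneous_fields_def)
  ultimately show ?thesis by (simp add: homogeneous_fields_def)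
qed

text \<open>The description in \<open>contraction\<close> has a unique solution because pairing with
  constant monomial fields reads off every coefficient of the relevant degree.\<close>

lemma V_flat_eq:
  assumes "A \<in> homogeneous_fields x k"
  shows "V_flat x coord_volume k A = volume_dual A"
proof (cases "k \<le> CARD('n)")
  case True
  have "\<eta> = volume_dual A"
    if \<eta>: "\<eta> \<in> homogeneous_fields x (CARD('n) - k)"
      and eq: "\<forall>B\<in>homogeneous_fields x (CARD('n) - k).
        pairing \<eta> B = pairing (volume_dual A) B" for \<eta>
  proof (intro ext)
    fix p J
    show "\<eta> p J = volume_dual A p J"
    proof (cases "card J = CARD('n) - k")
      case card: True
      have "(\<lambda>p. ext_basis J) \<in> homogeneous_fields x (CARD('n) - k)"
        using card by (auto simp: homogeneous_fields_def ext_basis_def smooth_const[OF chart])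
      then have "pairing \<eta> (\<lambda>p. ext_basis J) p = pairing (volume_dual A) (\<lambda>p. ext_basis J) p"
        using eq by simp
      then show ?thesis
        by (simp add: pairing_def ext_basis_def if_distrib[of "(*) _"] cong: if_cong)
    next
      case False
      then show ?thesis
        using \<eta> volume_dual_homogeneous[OF assms True] by (auto simp: homogeneous_fields_def)
    qed
  qed
  then show ?thesis
    using True volume_dual_homogeneous[OF assms True]
    unfolding V_flat_def contraction_def pairing_coord_volume_wedge
    by (auto intro!: the_equality)
next
  case False
  \<comment> \<open>Above the top degree \<open>contraction\<close> is zero by definition;
    \<open>A\<close> must vanish too, as no index set has \<open>k\<close> elements.\<close>
  have "A p I = 0" for p I
    using assms False card_mono[of UNIV I] by (auto simp: homogeneous_fields_def)
  then show ?thesis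
    using False by (auto simp: V_flat_def contraction_def volume_dual_def)
qed

text \<open>The inverse is evaluated at an image under \<open>V_flat\<close>, where injectivity
  fixes its value.\<close>

lemma V_natural_volume_dual:
  assumes "B \<in> homogeneous_fields x k"
  shows "V_natural x coord_volume k (volume_dual B) = B"
proof -
  have "inj_on (V_flat x coord_volume k) (homogeneous_fields x k)"
    using inj_volume_dual by (auto simp: inj_on_def V_flat_eq)
  then show ?thesis
    unfolding V_natural_def using assms by (intro the_inv_into_f_eq) (auto simp: V_flat_eq)
qed

lemma divergence_homogeneous:
  assumes "A \<in> homogeneous_fields x (Suc k)"
  shows "divergence x A \<in> homogeneous_fields x k"
proof -
  have "divergence x A p I = 0" if "card I \<noteq> k" for p I
  proof -
    \<comment> \<open>The coefficient has to vanish as a function, not only at \<open>p\<close>, for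
      its partial derivative to vanish.\<close>
    have "(\<lambda>q. A q (insert i I)) = (\<lambda>q. 0)" if "i \<notin> I" for i
      using assms \<open>card I \<noteq> k\<close> that by (auto simp: homogeneous_fields_def)
    then show ?thesis
      by (simp add: divergence_def chart_partial_const[OF chart])
  qed
  moreover have "(\<lambda>p. divergence x A p I) \<in> smooth_functions x" for I
    unfolding divergence_def using assms
    by (intro smooth_sum smooth_mult smooth_const smooth_chart_partial chart)
      (simp add: homogeneous_fields_def)
  ultimately show ?thesis by (simp add: homogeneous_fields_def)
qed

text \<open>Both sides differentiate the same coefficients of \<open>A\<close>, since removing
  \<open>i\<close> from \<open>K\<close> adds \<open>i\<close> to the complement. What remains is to
  match the signs.\<close>

lemma ext_deriv_volume_dual:
  assumes "A \<in> homogeneous_fields x k"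
  shows "ext_deriv x (volume_dual A) = volume_dual (divergence x A)"
proof (intro ext)
  fix p K
  have smooth: "(\<lambda>q. A q I) \<in> smooth_functions x" for I
    using assms by (simp add: homogeneous_fields_def)
  have summand: "wedge_sign {i} (K - {i}) *
        chart_partial x i (\<lambda>q. volume_dual A q (K - {i})) p =
      wedge_sign (- K) K *
        (wedge_sign (- K) {i} * chart_partial x i (\<lambda>q. A q (insert i (- K))) p)"
    if "i \<in> K" for i
  proof -
    define L where "L = K - {i}"
    have K: "K = {i} \<union> L" and compl: "- L = insert i (- K)" and disj: "{i} \<inter> L = {}"
      using that by (auto simp: L_def)
    have "wedge_sign (- L) L = wedge_sign {i} L * wedge_sign (- K) L"
      using wedge_sign_Un_left[of "{i}" "- K" L] that by (simp add: compl)
    moreover have "wedge_sign (- K) K = wedge_sign (- K) {i} * wedge_sign (- K) L"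
      using wedge_sign_Un_right[OF disj, of "- K"] K by simp
    \<comment> \<open>Both products reduce to \<open>wedge_sign (- K) L\<close>, because the
      repeated signs square to 1.\<close>
    ultimately have "wedge_sign {i} L * wedge_sign (- L) L =
        wedge_sign (- K) K * wedge_sign (- K) {i}"
      using wedge_sign_mult_self[of "{i}" L] wedge_sign_mult_self[of "- K" "{i}"]
      by (simp add: mult.assoc mult.left_commute)
    moreover have "chart_partial x i (\<lambda>q. volume_dual A q L) p =
        wedge_sign (- L) L * chart_partial x i (\<lambda>q. A q (insert i (- K))) p"
      by (simp add: volume_dual_def chart_partial_cmult[OF chart] smooth compl)
    ultimately show ?thesis
      by (simp add: L_def mult.assoc[symmetric])
  qed
  have "ext_deriv x (volume_dual A) p K =
      (\<Sum>i\<in>K. wedge_sign {i} (K - {i}) * chart_partial x i (\<lambda>q. volume_dual A q (K - {i})) p)"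
    unfolding ext_deriv_def wedge_field_def coord_form_def wedge_ext_basis_left
    by (rule sum.mono_neutral_cong_right) auto
  also have "\<dots> = volume_dual (divergence x A) p K"
    \<comment> \<open>Only the outer dual is unfolded, so that \<open>volume_dual A\<close> still
      matches \<open>summand\<close>.\<close>
    by (simp add: summand volume_dual_def[of "divergence x A"])
      (simp add: divergence_def sum_distrib_left)
  finally show "ext_deriv x (volume_dual A) p K = volume_dual (divergence x A) p K" .
qed

lemma curl_eq_divergence:
  assumes "A \<in> homogeneous_fields x (Suc k)"
  shows "curl x coord_volume (Suc k) A = divergence x A"
  using assms
  by (simp add: curl_def V_flat_eq ext_deriv_volume_dual V_natural_volume_dual
      divergence_homogeneous)

end

section \<open>The curl formula specialised to bivectors\<close>

theorem proposition3p5: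
  fixes x :: "'m::topological_space \<Rightarrow> real ^ 'n::{finite,linorder}"
    and V \<pi> :: "('m, 'n) ext_field"
    and c :: "'n \<Rightarrow> 'n \<Rightarrow> 'm \<Rightarrow> real"
    and m :: "'m \<Rightarrow> real"
  assumes chart: "global_chart x"
    and volume: "V = coord_volume"
    and skew: "\<And>i j p. c j i p = - c i j p" "\<And>i p. c i i p = 0"
    and components: "\<pi> = (\<lambda>p I. \<Sum>(i, j)\<in>{(i, j). i < j}.
          scale_field (c i j) (wedge_field (coord_vector_field i) (coord_vector_field j)) p I)"
    and poisson: "poisson_bivector x \<pi>"
    and smooth_m: "m \<in> smooth_functions x"
  shows "last_multiplier x V \<pi> m \<longleftrightarrow>
    (\<forall>i p. (\<Sum>j\<in>UNIV. chart_partial x j (\<lambda>q. m q * c i j q) p) = 0)"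
proof -
  define A where "A = scale_field m \<pi>"
  \<comment> \<open>The degree 2 is written \<open>Suc 1\<close> to fit
    \<open>curl_eq_divergence\<close>.\<close>
  have A: "A \<in> homogeneous_fields x (Suc 1)"
    using poisson smooth_m
    by (auto simp: poisson_bivector_def homogeneous_fields_def A_def scale_field_def
        numeral_2_eq_2 intro!: smooth_mult[OF chart])
  have coeff_less: "\<pi> p {a, b} = c a b p" if "a < b" for a b p
  proof -
    have "\<pi> p {a, b} = (\<Sum>(i, j)\<in>{(i, j). i < j}. if (i, j) = (a, b) then c a b p else 0)"
      unfolding components
    proof (rule sum.cong[OF refl], clarify)
      fix i j :: 'n assume "i < j"
      \<comment> \<open>An unordered pair has only one increasing ordering, so a single summand
        survives.\<close>
      moreover from this have "{a, b} = {i, j} \<longleftrightarrow> (i, j) = (a, b)"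
        using that by (auto simp: doubleton_eq_iff)
      ultimately show "scale_field (c i j)
          (wedge_field (coord_vector_field i) (coord_vector_field j)) p {a, b} =
          (if (i, j) = (a, b) then c a b p else 0)"
        by (simp add: scale_field_def wedge_coord_vector_fields ext_basis_def)
    qed
    also have "\<dots> = (\<Sum>z\<in>{(i, j). i < j}. if z = (a, b) then c a b p else 0)"
      by (intro sum.cong) (auto split: if_splits)
    finally show ?thesis using that by (simp add: sum.delta)
  qed
  \<comment> \<open>For \<open>j < i\<close> the sign is -1 and the stored coefficient is
    \<open>c j i\<close>; skew-symmetry turns the product into \<open>c i j\<close>, as in the case
    \<open>i < j\<close>.\<close>
  have coeff: "wedge_sign {i} {j} * A q {j, i} = m q * c i j q" if "i \<noteq> j" for i j q
    using that coeff_less[of i j q] coeff_less[of j i q] skew(1)[of i j q]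
    by (cases i j rule: linorder_cases)
      (auto simp: A_def scale_field_def wedge_sign_singletons insert_commute)
  have div: "divergence x A p {i} = (\<Sum>j\<in>UNIV. chart_partial x j (\<lambda>q. m q * c i j q) p)" for i p
  proof -
    have "divergence x A p {i} = (\<Sum>j\<in>- {i}. chart_partial x j (\<lambda>q. m q * c i j q) p)"
      unfolding divergence_def
    proof (rule sum.cong[OF refl])
      fix j assume "j \<in> - {i}"
      \<comment> \<open>Smoothness is known for the coefficients of \<open>A\<close>, so the
        derivative is computed through them.\<close>
      then have "(\<lambda>q. m q * c i j q) = (\<lambda>q. wedge_sign {i} {j} * A q (insert j {i}))"
        using coeff[of i j] by auto
      moreover have "(\<lambda>q. A q (insert j {i})) \<in> smooth_functions x"
        using A by (simp add: homogeneous_fields_def)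
      ultimately show "wedge_sign {i} {j} * chart_partial x j (\<lambda>q. A q (insert j {i})) p =
          chart_partial x j (\<lambda>q. m q * c i j q) p"
        by (simp add: chart_partial_cmult[OF chart])
    qed
    also have "\<dots> = (\<Sum>j\<in>UNIV. chart_partial x j (\<lambda>q. m q * c i j q) p)"
      \<comment> \<open>The added diagonal term is the derivative of the zero function, as
        \<open>c i i\<close> vanishes identically.\<close>
      by (rule sum.mono_neutral_left) (auto simp: skew(2) chart_partial_const[OF chart])
    finally show ?thesis .
  qed
  have "last_multiplier x V \<pi> m \<longleftrightarrow> (\<forall>p I. divergence x A p I = 0)"
    using curl_eq_divergence[OF chart A]
    by (simp add: last_multiplier_def volume A_def numeral_2_eq_2 fun_eq_iff)
  \<comment> \<open>The divergence of a bivector field has degree 1, so only singleton index sets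
    carry a condition.\<close>
  also have "\<dots> \<longleftrightarrow> (\<forall>i p. divergence x A p {i} = 0)"
  proof (intro iffI allI)
    fix p I
    assume zero: "\<forall>i p. divergence x A p {i} = 0"
    show "divergence x A p I = 0"
    proof (cases "card I = 1")
      case True
      then obtain i where "I = {i}" by (rule card_1_singletonE)
      then show ?thesis using zero by simp
    next
      case False
      then show ?thesis
        using divergence_homogeneous[OF chart A] by (simp add: homogeneous_fields_def)
    qed
  qed simp
  finally show ?thesis by (simp add: div)
qed

end
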